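(* Let $L$ be the operator generated by a kernel $k$ (symmetric, integrable, non-trivial, nonnegative, $k(0)=0$). If $k$ has finite support, then $L$ satisfies $CD_\Upsilon(0,F)$ with the $CD$-function $F(r)=c_0\,|k|_1\, H\big(\tfrac{r}{|k|_1}\big)$, $r\ge 0$, where $c_0=\min_{j\in \mathrm{supp}(k)}k(j)>0$ and $H(x)=\frac12 e^{-x}\Upsilon(2x)$ for $x\in\mathbb{R}$.
   Context: Kernel and operator: $k:\mathbb{Z}\to[0,\infty)$ is not identically zero, $k(0)=0$, $k(j)=k(-j)$ for all $j$, and $|k|_1:=\sum_{j\in\mathbb{Z}}k(j)<\infty$. The operator generated by $k$ is $Lu(x)=\sum_{j\in\mathbb{Z}}k(j)\big(u(x+j)-u(x)\big)$, $x\in\mathbb{Z}$. $\mathrm{supp}(k)=\{j\in\mathbb{Z}:k(j)\neq 0\}$. $\ell^\infty(\mathbb{Z})$ denotes the bounded functions $\mathbb{Z}\to\mathbb{R}$. Let $\Upsilon(r)=e^r-1-r$, $r\in\mathbb{R}$. For $u,v\in\ell^\infty(\mathbb{Z})$ put $\Psi_\Upsilon(u)(x)=\sum_{y\in\mathbb{Z}}k(x-y)\Upsilon(u(y)-u(x))$, $B_{\Upsilon'}(u,v)(x)=\sum_{y\in\mathbb{Z}}k(x-y)\Upsilon'(u(y)-u(x))(v(y)-v(x))$ and $\Psi_{2,\Upsilon}(u)(x)=\frac12\big(L\Psi_\Upsilon(u)(x)-B_{\Upsilon'}(u,Lu)(x)\big)$. A $CD$-function is a continuous $F:[0,\infty)\to[0,\infty)$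 with $F(0)=0$, $r\mapsto F(r)/r$ strictly increasing on $(0,\infty)$, and $1/F$ integrable at $\infty$. $L$ satisfies $CD_\Upsilon(0,F)$ if for every $u\in\ell^\infty(\mathbb{Z})$ and every $x\in\mathbb{Z}$: $\Psi_{2,\Upsilon}(u)(x)\ge F(-Lu(x))$ whenever $-Lu(x)\ge 0$ (and $\Psi_{2,\Upsilon}(u)(x)\ge 0$ otherwise). *)

theory Defs
  imports "HOL-Analysis.Analysis"
begin

definition supp :: "(int \<Rightarrow> real) \<Rightarrow> int set" where
  "supp k = {j. k j \<noteq> 0}"

definition admissible_kernel :: "(int \<Rightarrow> real) \<Rightarrow> bool" where
  "admissible_kernel k \<longleftrightarrow>
     (\<forall>j. k j \<ge> 0) \<and> k \<noteq> (\<lambda>_. 0) \<and> k 0 = 0 \<and> (\<forall>j. k j = k (- j)) \<and> k summable_on UNIV"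

definition l1_norm :: "(int \<Rightarrow> real) \<Rightarrow> real" where
  "l1_norm k = (\<Sum>\<^sub>\<infinity>j. k j)"

definition linf :: "(int \<Rightarrow> real) set" where
  "linf = {u. bounded (range u)}"

definition gen_op :: "(int \<Rightarrow> real) \<Rightarrow> (int \<Rightarrow> real) \<Rightarrow> int \<Rightarrow> real" where
  "gen_op k u x = (\<Sum>\<^sub>\<infinity>j. k j * (u (x + j) - u x))"

definition Upsilon :: "real \<Rightarrow> real" where
  "Upsilon r = exp r - 1 - r"

definition Psi_op :: "(real \<Rightarrow> real) \<Rightarrow> (int \<Rightarrow> real) \<Rightarrow> (int \<Rightarrow> real) \<Rightarrow> int \<Rightarrow> real" where
  "Psi_op G k u x = (\<Sum>\<^sub>\<infinity>y. k (x - y) * G (u y - u x))"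

definition B_op ::
  "(real \<Rightarrow> real) \<Rightarrow> (int \<Rightarrow> real) \<Rightarrow> (int \<Rightarrow> real) \<Rightarrow> (int \<Rightarrow> real) \<Rightarrow> int \<Rightarrow> real" where
  "B_op G k u v x = (\<Sum>\<^sub>\<infinity>y. k (x - y) * G (u y - u x) * (v y - v x))"

definition Psi2_Upsilon :: "(int \<Rightarrow> real) \<Rightarrow> (int \<Rightarrow> real) \<Rightarrow> int \<Rightarrow> real" where
  "Psi2_Upsilon k u x =
     (gen_op k (Psi_op Upsilon k u) x - B_op (deriv Upsilon) k u (gen_op k u) x) / 2"

(* A function on [0,\<infinity>) is represented by a total function of which only the values on {0..} matter.
   The properties listed before the last one force F > 0 on {0<..}, so 1/F has no artificial value
   (Isabelle's 1/0 = 0) on {R..} for R > 0. *)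
definition CD_function :: "(real \<Rightarrow> real) \<Rightarrow> bool" where
  "CD_function F \<longleftrightarrow>
     continuous_on {0..} F \<and> (\<forall>r\<ge>0. F r \<ge> 0) \<and> F 0 = 0 \<and>
     strict_mono_on {0<..} (\<lambda>r. F r / r) \<and>
     (\<exists>R>0. set_integrable lborel {R..} (\<lambda>r. 1 / F r))"

(* The condition CD_Upsilon(0,F) for the operator generated by k. *)
definition CD_Upsilon_0 :: "(int \<Rightarrow> real) \<Rightarrow> (real \<Rightarrow> real) \<Rightarrow> bool" where
  "CD_Upsilon_0 k F \<longleftrightarrow>
     (\<forall>u\<in>linf. \<forall>x.
        (- gen_op k u x \<ge> 0 \<longrightarrow> Psi2_Upsilon k u x \<ge> F (- gen_op k u x)) \<and>
        (\<not> (- gen_op k u x \<ge> 0) \<longrightarrow> Psi2_Upsilon k u x \<ge> 0))"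

definition H_fun :: "real \<Rightarrow> real" where
  "H_fun x = 1 / 2 * exp (- x) * Upsilon (2 * x)"

end

theory Submission
  imports Defs
begin

text \<open>
  Fix \<open>x\<close> and write \<open>z j = u (x + j) - u x\<close>. Expanding the definition of
  \<open>\<Psi>\<^sub>2\<close> over pairs of jumps \<open>(i, j)\<close>, the path \<open>x \<rightarrow> x + i \<rightarrow> x + i + j\<close> and the path
  \<open>x \<rightarrow> x + j \<rightarrow> x + i + j\<close> have the same end point, because \<open>\<int>\<close> is commutative. Exchanging
  \<open>i\<close> and \<open>j\<close> therefore cancels an antisymmetric part, and what is left is a sum of nonnegative
  terms (lemma \<open>Psi2_Upsilon_eq_sum\<close>):
  \<open>2 \<Psi>\<^sub>2 = \<Sum> k(j) k(i) exp (z j) \<Upsilon>(z (i + j) - z i - z j)\<close>.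

  The value \<open>z (i + j)\<close> is out of control unless \<open>i = - j\<close>, when it is \<open>0\<close>. Keeping only these
  terms and bounding one factor \<open>k(j)\<close> from below by \<open>c\<^sub>0\<close> gives
  \<open>2 \<Psi>\<^sub>2 \<ge> c\<^sub>0 \<Sum> k(j) exp (z j) \<Upsilon>(- z j - z (- j))\<close>. Averaging over \<open>j\<close> and \<open>- j\<close>, the
  arithmetic-geometric mean inequality for \<open>exp (z j)\<close> and \<open>exp (z (- j))\<close> turns each term into
  \<open>2 H(t j)\<close> with \<open>t j = - (z j + z (- j)) / 2\<close> (lemma \<open>exp_mean_times_Upsilon_ge\<close>). The average
  of \<open>t\<close> with weights \<open>k(j) / |k|\<^sub>1\<close> is \<open>- L u(x) / |k|\<^sub>1\<close>, so Jensen's inequality for the convex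
  function \<open>H\<close> yields \<open>\<Psi>\<^sub>2 \<ge> c\<^sub>0 |k|\<^sub>1 H(- L u(x) / |k|\<^sub>1)\<close> (lemma \<open>Psi2_Upsilon_ge\<close>). As
  \<open>H \<ge> 0\<close> on the whole line, this covers both signs of \<open>- L u(x)\<close>.

  That \<open>F\<close> is a \<open>CD\<close>-function comes from the strict convexity of \<open>H\<close> together with \<open>H(0) = 0\<close>,
  and from the exponential growth of \<open>H\<close> at infinity.
\<close>

section \<open>The iterated operator as a sum of nonnegative terms\<close>

lemma infsum_kernel_eq_sum:
  fixes k f :: "int \<Rightarrow> real"
  assumes "finite (supp k)"
  shows "(\<Sum>\<^sub>\<infinity>j. k j * f j) = (\<Sum>j\<in>supp k. k j * f j)"
proof -
  have "(\<Sum>\<^sub>\<infinity>j. k j * f j) = (\<Sum>\<^sub>\<infinity>j\<in>supp k. k j * f j)"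
    by (rule infsum_cong_neutral) (auto simp: supp_def)
  with assms show ?thesis by simp
qed

lemma infsum_convolution_eq_sum:
  fixes k f :: "int \<Rightarrow> real"
  assumes "finite (supp k)" and "\<And>j. k j = k (- j)"
  shows "(\<Sum>\<^sub>\<infinity>y. k (x - y) * f y) = (\<Sum>j\<in>supp k. k j * f (x + j))"
proof -
  have "bij_betw (\<lambda>j. x + j) UNIV (UNIV :: int set)"
    by (rule bij_betwI[where g = "\<lambda>y. y - x"]) auto
  then have "(\<Sum>\<^sub>\<infinity>y. k (x - y) * f y) = (\<Sum>\<^sub>\<infinity>j. k (x - (x + j)) * f (x + j))"
    by (rule infsum_reindex_bij_betw[symmetric])
  also have "\<dots> = (\<Sum>\<^sub>\<infinity>j. k j * f (x + j))"
    using assms(2) by simp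
  finally show ?thesis
    using infsum_kernel_eq_sum[OF assms(1)] by simp
qed

lemma Upsilon_nonneg: "Upsilon r \<ge> 0"
  using exp_ge_add_one_self[of r] unfolding Upsilon_def by linarith

lemma deriv_Upsilon: "deriv Upsilon = (\<lambda>r. exp r - 1)"
  unfolding Upsilon_def[abs_def]
  by (rule ext, rule DERIV_imp_deriv) (auto intro!: derivative_eq_intros)

text \<open>
  Applied to \<open>w = z (i + j)\<close>, the right-hand side is the \<open>(i, j)\<close> term of \<open>2 \<Psi>\<^sub>2\<close> up to
  a term that changes sign when \<open>i\<close> and \<open>j\<close> are exchanged.
\<close>

lemma exp_times_Upsilon:
  "exp b * Upsilon (w - a - b) = exp (w - a) - exp b - exp b * (w - a - b)"
  by (simp add: Upsilon_def algebra_simps flip: exp_add)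

text \<open>
  The formula rests on commutativity of the jumps: \<open>z x (i + j)\<close> is symmetric in \<open>i\<close> and \<open>j\<close>, so
  the defining summand differs from the one below by an antisymmetric function of \<open>(i, j)\<close>, which
  sums to zero. All terms that remain are nonnegative, and hence any of them may be dropped in a
  lower bound.
\<close>

lemma Psi2_Upsilon_eq_sum:
  fixes k u :: "int \<Rightarrow> real"
  assumes fin: "finite (supp k)" and sym: "\<And>j. k j = k (- j)"
  defines "z \<equiv> \<lambda>x j. u (x + j) - u x"
  shows "2 * Psi2_Upsilon k u x =
    (\<Sum>j\<in>supp k. \<Sum>i\<in>supp k. k j * k i * (exp (z x j) * Upsilon (z x (i + j) - z x i - z x j)))"
proof -
  define S where "S = supp k"
  \<comment> \<open>The \<open>(j, i)\<close> summand differs from the claimed one by \<open>d j i - d i j\<close>.\<close>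
  define d where "d = (\<lambda>j i. k j * k i * exp (z x (i + j) - z x j) + k j * k i * exp (z x j))"
  have L: "gen_op k u y = (\<Sum>i\<in>S. k i * z y i)" for y
    unfolding gen_op_def z_def S_def by (rule infsum_kernel_eq_sum[OF fin])
  have P: "Psi_op Upsilon k u y = (\<Sum>i\<in>S. k i * Upsilon (z y i))" for y
    unfolding Psi_op_def z_def S_def
    using infsum_convolution_eq_sum[OF fin sym, where f = "\<lambda>y'. Upsilon (u y' - u y)"] by simp
  have B: "B_op (deriv Upsilon) k u v x = (\<Sum>j\<in>S. k j * ((exp (z x j) - 1) * (v (x + j) - v x)))" for v
    unfolding B_op_def z_def S_def deriv_Upsilon mult.assoc
    using infsum_convolution_eq_sum[OF fin sym, where f = "\<lambda>y'. (exp (u y' - u x) - 1) * (v y' - v x)"]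
    by simp
  have zz: "z (x + j) i = z x (i + j) - z x j" for i j
    by (simp add: z_def algebra_simps)
  have "2 * Psi2_Upsilon k u x =
      (\<Sum>j\<in>S. k j * (Psi_op Upsilon k u (x + j) - Psi_op Upsilon k u x))
      - (\<Sum>j\<in>S. k j * ((exp (z x j) - 1) * (gen_op k u (x + j) - gen_op k u x)))"
    unfolding Psi2_Upsilon_def B
    using infsum_kernel_eq_sum[OF fin, where f = "\<lambda>j. Psi_op Upsilon k u (x + j) - Psi_op Upsilon k u x"]
    by (simp add: gen_op_def[of _ "Psi_op Upsilon k u"] S_def)
  also have "\<dots> = (\<Sum>j\<in>S. \<Sum>i\<in>S. k j * k i *
      (Upsilon (z (x + j) i) - Upsilon (z x i) - (exp (z x j) - 1) * (z (x + j) i - z x i)))"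
    unfolding L P
    by (simp only: sum_subtractf[symmetric] sum_distrib_left) (intro sum.cong refl, simp add: algebra_simps)
  also have "\<dots> = (\<Sum>j\<in>S. \<Sum>i\<in>S.
      k j * k i * (exp (z x j) * Upsilon (z x (i + j) - z x i - z x j)) + (d j i - d i j))"
    unfolding zz exp_times_Upsilon d_def
    unfolding Upsilon_def
    by (intro sum.cong refl) (simp add: algebra_simps)
  also have "\<dots> = (\<Sum>j\<in>S. \<Sum>i\<in>S.
      k j * k i * (exp (z x j) * Upsilon (z x (i + j) - z x i - z x j)))"
    using sum.swap[of d S S] by (simp add: sum.distrib sum_subtractf)
  finally show ?thesis unfolding S_def .
qed

section \<open>The function \<open>H\<close> and the \<open>CD\<close>-function\<close>

definition H_deriv :: "real \<Rightarrow> real" where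
  "H_deriv x = 1 / 2 * (exp x + exp (- x) * (2 * x - 1))"

lemma H_fun_alt: "H_fun x = 1 / 2 * (exp x - exp (- x) * (1 + 2 * x))"
  by (simp add: H_fun_def Upsilon_def algebra_simps flip: exp_add)

lemma H_fun_0: "H_fun 0 = 0"
  by (simp add: H_fun_alt)

lemma H_fun_nonneg: "H_fun x \<ge> 0"
  by (simp add: H_fun_def Upsilon_nonneg)

lemma has_derivative_H_fun: "(H_fun has_real_derivative H_deriv x) (at x)"
  unfolding H_fun_alt[abs_def] H_deriv_def
  by (auto intro!: derivative_eq_intros simp: algebra_simps)

lemma has_derivative_H_deriv:
  "(H_deriv has_real_derivative 1 / 2 * exp (- x) * (exp (2 * x) + 3 - 2 * x)) (at x)"
  unfolding H_deriv_def[abs_def]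
  by (auto intro!: derivative_eq_intros simp: algebra_simps simp flip: exp_add)

lemma H_second_deriv_pos: "1 / 2 * exp (- x) * (exp (2 * x) + 3 - 2 * x) > (0::real)"
proof -
  have "exp (2 * x) + 3 - 2 * x > 0"
    using exp_ge_add_one_self[of "2 * x"] by linarith
  then show ?thesis by simp
qed

lemma convex_on_H_fun: "convex_on UNIV H_fun"
  using has_derivative_H_fun has_derivative_H_deriv H_second_deriv_pos
  by (intro f''_ge0_imp_convex) (auto intro: less_imp_le simp del: mult_pos_pos)

lemma H_deriv_strict_mono: "x < y \<Longrightarrow> H_deriv x < H_deriv y"
  by (rule DERIV_pos_imp_increasing) (use has_derivative_H_deriv H_second_deriv_pos in blast)+

text \<open>
  By the mean value theorem, \<open>f r / r\<close> is a value of \<open>f'\<close> on \<open>(0, r)\<close> and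
  \<open>(f s - f r) / (s - r)\<close> is one on \<open>(r, s)\<close>, hence larger; \<open>f s / s\<close> is a weighted mean of
  the two.
\<close>

lemma strict_mono_on_divide_self:
  fixes f f' :: "real \<Rightarrow> real"
  assumes "\<And>x. (f has_real_derivative f' x) (at x)" "\<And>x y. x < y \<Longrightarrow> f' x < f' y" "f 0 = 0"
  shows "strict_mono_on {0<..} (\<lambda>x. f x / x)"
proof (rule strict_mono_onI)
  fix r s :: real
  assume "r \<in> {0<..}" "s \<in> {0<..}" "r < s"
  then have rs: "0 < r" "r < s" by auto
  from MVT2[of 0 r f f'] rs assms obtain a where a: "a < r" "f r = r * f' a" by auto
  from MVT2[of r s f f'] rs assms obtain b where b: "r < b" "f s - f r = (s - r) * f' b" by auto
  have "(s - r) * f' a < (s - r) * f' b"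
    using a b rs assms(2)[of a b] by simp
  with a b have "s * f' a < f s" by (simp add: algebra_simps)
  with a rs show "f r / r < f s / s" by (simp add: field_simps)
qed

text \<open>
  The growth that makes \<open>1 / F\<close> integrable at infinity. The quadratic Taylor bound for
  \<open>exp (2 * x)\<close> is enough to absorb the negative part of \<open>H\<close> into half of its leading term
  \<open>exp x / 2\<close> once \<open>x \<ge> 2\<close>.
\<close>

lemma H_fun_ge_exp:
  assumes "x \<ge> 2"
  shows "H_fun x \<ge> exp x / 4"
proof -
  have "2 * x \<le> x\<^sup>2"
    using assms by (simp add: power2_eq_square)
  then have "2 * (1 + 2 * x) \<le> 1 + 2 * x + (2 * x)\<^sup>2 / 2"
    using assms by (simp add: power_mult_distrib)
  also have "\<dots> \<le> exp (2 * x)"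
    using exp_lower_Taylor_quadratic[of "2 * x"] assms by simp
  finally have "exp (- x) * (1 + 2 * x) \<le> exp (- x) * (exp (2 * x) / 2)" by simp
  also have "\<dots> = exp x / 2" by (simp flip: exp_add)
  finally show ?thesis by (simp add: H_fun_alt)
qed

lemma set_integrable_exp_minus:
  fixes a R :: real
  assumes "a > 0"
  shows "set_integrable lborel {R..} (\<lambda>r. exp (- a * r))"
proof -
  have "(\<lambda>r. exp (- a * r)) absolutely_integrable_on {R..}"
    using integrable_on_exp_minus_to_infinity[OF assms]
    by (intro nonnegative_absolutely_integrable_1) auto
  then show ?thesis
    by (simp add: set_integrable_def integrable_completion)
qed

lemma CD_function_H:
  assumes c: "c > 0" and K: "K > 0"
  shows "CD_function (\<lambda>r. c * K * H_fun (r / K))"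
  unfolding CD_function_def
proof (intro conjI)
  have "continuous_on UNIV H_fun"
    by (rule DERIV_continuous_on[OF has_derivative_H_fun])
  then show "continuous_on {0..} (\<lambda>r. c * K * H_fun (r / K))"
    using K by (intro continuous_on_mult_left, elim continuous_on_compose2)
      (auto intro!: continuous_on_divide)
  show "\<forall>r\<ge>0. c * K * H_fun (r / K) \<ge> 0"
    using c K by (simp add: H_fun_nonneg)
  show "c * K * H_fun (0 / K) = 0" by (simp add: H_fun_0)
  have mono: "strict_mono_on {0<..} (\<lambda>x. H_fun x / x)"
    by (rule strict_mono_on_divide_self[OF has_derivative_H_fun H_deriv_strict_mono H_fun_0])
  show "strict_mono_on {0<..} (\<lambda>r. c * K * H_fun (r / K) / r)"
  proof (rule strict_mono_onI)
    fix r s :: real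
    assume "r \<in> {0<..}" "s \<in> {0<..}" "r < s"
    with K have "H_fun (r / K) / (r / K) < H_fun (s / K) / (s / K)"
      by (intro strict_mono_onD[OF mono]) (auto simp: divide_strict_right_mono)
    then have "c * (H_fun (r / K) / (r / K)) < c * (H_fun (s / K) / (s / K))"
      using c by (rule mult_strict_left_mono)
    moreover have "c * K * H_fun (q / K) / q = c * (H_fun (q / K) / (q / K))" for q
      by simp
    ultimately show "c * K * H_fun (r / K) / r < c * K * H_fun (s / K) / s"
      by (simp only:)
  qed
  have bound: "norm (1 / (c * K * H_fun (r / K))) \<le> norm (4 / (c * K) * exp (- (1 / K) * r))"
    if "r \<ge> 2 * K" for r
  proof -
    have "r / K \<ge> 2" using that K by (simp add: field_simps)
    then have "exp (r / K) / 4 \<le> H_fun (r / K)" by (rule H_fun_ge_exp)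
    then have "c * K * (exp (r / K) / 4) \<le> c * K * H_fun (r / K)"
      using c K by simp
    moreover have "0 < c * K * (exp (r / K) / 4)"
      using c K by simp
    ultimately have "1 / (c * K * H_fun (r / K)) \<le> 1 / (c * K * (exp (r / K) / 4))"
      by (simp only: frac_le)
    also have "\<dots> = 4 / (c * K) * exp (- (1 / K) * r)"
      by (simp add: exp_minus field_simps)
    finally show ?thesis using c K by (simp add: H_fun_nonneg)
  qed
  have "set_integrable lborel {2 * K..} (\<lambda>r. 1 / (c * K * H_fun (r / K)))"
  proof (rule set_integrable_bound)
    show "set_integrable lborel {2 * K..} (\<lambda>r. 4 / (c * K) * exp (- (1 / K) * r))"
      using set_integrable_exp_minus[of "1 / K" "2 * K"] K by (intro set_integrable_mult_right) simp
    have "(\<lambda>r. 1 / (c * K * H_fun (r / K))) \<in> borel_measurable borel"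
      unfolding H_fun_alt by measurable
    then show "set_borel_measurable lborel {2 * K..} (\<lambda>r. 1 / (c * K * H_fun (r / K)))"
      unfolding set_borel_measurable_def by measurable
    show "AE r in lborel. r \<in> {2 * K..} \<longrightarrow>
        norm (1 / (c * K * H_fun (r / K))) \<le> norm (4 / (c * K) * exp (- (1 / K) * r))"
      using bound by (intro AE_I2) auto
  qed
  then show "\<exists>R>0. set_integrable lborel {R..} (\<lambda>r. 1 / (c * K * H_fun (r / K)))"
    using K by (intro exI[of _ "2 * K"]) simp
qed

section \<open>The curvature-dimension inequality\<close>

text \<open>
  The arithmetic-geometric mean inequality \<open>exp a + exp b \<ge> 2 exp ((a + b) / 2)\<close>, multiplied by
  \<open>\<Upsilon>(- a - b) \<ge> 0\<close>. The definition of \<open>H\<close> is such that at \<open>- (a + b) / 2\<close> it is exactly half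
  of \<open>exp ((a + b) / 2) \<Upsilon>(- a - b)\<close>. The two arguments of \<open>\<Upsilon>\<close> are written in the order in which they
  arise from the jumps \<open>j\<close> and \<open>- j\<close>.
\<close>

lemma exp_mean_times_Upsilon_ge:
  "exp a * Upsilon (- b - a) + exp b * Upsilon (- a - b) \<ge> 4 * H_fun (- (a + b) / 2)"
proof -
  have "0 \<le> (exp (a / 2) - exp (b / 2))\<^sup>2" by simp
  also have "\<dots> = exp a + exp b - 2 * exp ((a + b) / 2)"
    by (simp add: power2_eq_square algebra_simps add_divide_distrib flip: exp_add)
  finally have "(2 * exp ((a + b) / 2)) * Upsilon (- a - b) \<le> (exp a + exp b) * Upsilon (- a - b)"
    by (intro mult_right_mono Upsilon_nonneg) simp
  moreover have "4 * H_fun (- (a + b) / 2) = (2 * exp ((a + b) / 2)) * Upsilon (- a - b)"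
  proof -
    have "2 * (- (a + b) / 2) = - a - b" "- (- (a + b) / 2) = (a + b) / 2"
      by (simp_all add: field_simps)
    then show ?thesis by (simp only: H_fun_def)
  qed
  moreover have "- b - a = - a - b" by simp
  ultimately show ?thesis by (simp only: distrib_right)
qed

text \<open>
  Of the double sum for \<open>2 \<Psi>\<^sub>2\<close> only the return paths \<open>i = - j\<close> are kept: there the second-order
  increment is \<open>- z j - z (- j)\<close>, whose sum with weights \<open>k\<close> is \<open>- 2 L u(x)\<close>. One of the two factors
  \<open>k j * k (- j)\<close> is spent on the constant \<open>c\<close>, the other one supplies the weights for Jensen's
  inequality.
\<close>

lemma Psi2_Upsilon_ge:
  fixes k u :: "int \<Rightarrow> real"
  assumes fin: "finite (supp k)" and sym: "\<And>j. k j = k (- j)" and nonneg: "\<And>j. k j \<ge> 0"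
    and c: "\<And>j. j \<in> supp k \<Longrightarrow> c \<le> k j" "c \<ge> 0" and K: "l1_norm k > 0"
  shows "Psi2_Upsilon k u x \<ge> c * l1_norm k * H_fun (- gen_op k u x / l1_norm k)"
proof -
  define S where "S = supp k"
  define z where "z = (\<lambda>j. u (x + j) - u x)"
  define g where "g = (\<lambda>j. exp (z j) * Upsilon (- z (- j) - z j))"
  define t where "t = (\<lambda>j. - (z j + z (- j)) / 2)"
  define K where "K = l1_norm k"
  have finS: "finite S" using fin by (simp add: S_def)
  have negS: "- j \<in> S \<longleftrightarrow> j \<in> S" for j
    using sym[of j] by (simp add: S_def supp_def)
  have reflect: "(\<Sum>j\<in>S. h (- j)) = (\<Sum>j\<in>S. h j)" for h :: "int \<Rightarrow> real"
    by (rule sum.reindex_bij_witness[of _ uminus uminus]) (auto simp: negS)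
  have KS: "K = (\<Sum>j\<in>S. k j)"
    using infsum_kernel_eq_sum[OF fin, where f = "\<lambda>_. 1"] by (simp add: K_def l1_norm_def S_def)
  have K0: "K > 0" using K by (simp add: K_def)
  have "S \<noteq> {}" using KS K0 by auto
  have g_nonneg: "g j \<ge> 0" for j by (simp add: g_def Upsilon_nonneg)

  \<comment> \<open>Jensen's inequality with the probability weights \<open>k j / K\<close>.\<close>
  have mean: "(\<Sum>j\<in>S. k j / K * t j) = - gen_op k u x / K"
  proof -
    have "(\<Sum>j\<in>S. k j * z (- j)) = (\<Sum>j\<in>S. k j * z j)"
      using reflect[of "\<lambda>j. k j * z j"] sym by simp
    then have "(\<Sum>j\<in>S. k j * t j) = - (\<Sum>j\<in>S. k j * z j)"
      by (simp add: t_def ring_distribs sum.distrib sum_negf sum_subtractf flip: sum_divide_distrib)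
    moreover have "gen_op k u x = (\<Sum>j\<in>S. k j * z j)"
      unfolding gen_op_def S_def z_def by (rule infsum_kernel_eq_sum[OF fin])
    ultimately show ?thesis by (simp flip: sum_divide_distrib)
  qed
  have "H_fun (\<Sum>j\<in>S. (k j / K) *\<^sub>R t j) \<le> (\<Sum>j\<in>S. k j / K * H_fun (t j))"
    using finS \<open>S \<noteq> {}\<close> nonneg K0
    by (intro convex_on_sum[OF _ _ convex_on_H_fun]) (auto simp flip: sum_divide_distrib KS)
  then have "K * H_fun (- gen_op k u x / K) \<le> K * (\<Sum>j\<in>S. k j / K * H_fun (t j))"
    using mean K0 by simp
  also have "\<dots> = (\<Sum>j\<in>S. k j * H_fun (t j))"
    using K0 by (simp add: sum_distrib_left)
  finally have jensen: "c * (K * H_fun (- gen_op k u x / K)) \<le> c * (\<Sum>j\<in>S. k j * H_fun (t j))"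
    using c by (intro mult_left_mono)

  \<comment> \<open>Pairing \<open>j\<close> with \<open>- j\<close> produces the values \<open>H (t j)\<close>.\<close>
  have "4 * (\<Sum>j\<in>S. k j * H_fun (t j)) = (\<Sum>j\<in>S. k j * (4 * H_fun (t j)))"
    by (simp add: sum_distrib_left algebra_simps)
  also have "\<dots> \<le> (\<Sum>j\<in>S. k j * (g j + g (- j)))"
  proof (intro sum_mono mult_left_mono nonneg)
    fix j
    show "4 * H_fun (t j) \<le> g j + g (- j)"
      using exp_mean_times_Upsilon_ge[of "z j" "z (- j)"]
      by (simp only: g_def t_def minus_minus)
  qed
  also have "\<dots> = 2 * (\<Sum>j\<in>S. k j * g j)"
    using reflect[of "\<lambda>j. k j * g j"] sym by (simp add: ring_distribs sum.distrib)
  finally have "c * (\<Sum>j\<in>S. k j * H_fun (t j)) * 2 \<le> c * (\<Sum>j\<in>S. k j * g j)"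
    using mult_left_mono[OF _ c(2)] by fastforce
  also have "\<dots> = (\<Sum>j\<in>S. c * (k j * g j))" by (simp add: sum_distrib_left)
  also have "\<dots> \<le> (\<Sum>j\<in>S. k j * (k j * g j))"
    using c(1) by (intro sum_mono mult_right_mono) (auto simp: S_def nonneg g_nonneg)
  also have "\<dots> \<le> (\<Sum>j\<in>S. \<Sum>i\<in>S. k j * k i * (exp (z j) * Upsilon (z (i + j) - z i - z j)))"
  proof (rule sum_mono)
    \<comment> \<open>The left-hand side is the single term \<open>i = - j\<close> of the inner sum.\<close>
    fix j assume "j \<in> S"
    have "z 0 = 0" by (simp add: z_def)
    then have "k j * (k j * g j) =
        k j * k (- j) * (exp (z j) * Upsilon (z (- j + j) - z (- j) - z j))"
      using sym[of j] by (simp add: g_def algebra_simps)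
    also have "\<dots> \<le> (\<Sum>i\<in>S. k j * k i * (exp (z j) * Upsilon (z (i + j) - z i - z j)))"
      using \<open>j \<in> S\<close> finS
      by (intro member_le_sum[of "- j"]) (auto simp: negS nonneg Upsilon_nonneg)
    finally show "k j * (k j * g j) \<le>
        (\<Sum>i\<in>S. k j * k i * (exp (z j) * Upsilon (z (i + j) - z i - z j)))" .
  qed
  also have "\<dots> = 2 * Psi2_Upsilon k u x"
    unfolding S_def z_def by (rule Psi2_Upsilon_eq_sum[OF fin sym, symmetric])
  finally show ?thesis using jensen by (simp add: K_def mult.assoc)
qed

theorem corollary2p6:
  fixes k :: "int \<Rightarrow> real"
  assumes "admissible_kernel k"
    and "finite (supp k)"
  shows "let c0 = Min (k ` supp k);
             F = (\<lambda>r. c0 * l1_norm k * H_fun (r / l1_norm k))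
         in c0 > 0 \<and> CD_function F \<and> CD_Upsilon_0 k F"
proof -
  define c where "c = Min (k ` supp k)"
  have nonneg: "\<And>j. k j \<ge> 0" and sym: "\<And>j. k j = k (- j)" and ne: "supp k \<noteq> {}"
    using assms(1) by (auto simp: admissible_kernel_def supp_def)
  have pos: "k j > 0" if "j \<in> supp k" for j
    using that nonneg[of j] by (simp add: supp_def)
  have c0: "c > 0"
    using assms(2) ne pos by (simp add: c_def)
  have le: "c \<le> k j" if "j \<in> supp k" for j
    using assms(2) that by (simp add: c_def)
  have "l1_norm k = (\<Sum>j\<in>supp k. k j)"
    using infsum_kernel_eq_sum[OF assms(2), where f = "\<lambda>_. 1"] by (simp add: l1_norm_def)
  then have K: "l1_norm k > 0"
    using assms(2) ne pos by (simp add: sum_pos)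
  have ge: "c * l1_norm k * H_fun (- gen_op k u x / l1_norm k) \<le> Psi2_Upsilon k u x" for u x
    using Psi2_Upsilon_ge[OF assms(2) sym nonneg le _ K] c0 by simp
  have "0 \<le> Psi2_Upsilon k u x" for u x
    using ge[of u x] c0 K by (meson H_fun_nonneg less_imp_le mult_nonneg_nonneg order_trans)
  with ge have "CD_Upsilon_0 k (\<lambda>r. c * l1_norm k * H_fun (r / l1_norm k))"
    by (simp add: CD_Upsilon_0_def)
  with c0 CD_function_H[OF c0 K] show ?thesis
    by (simp add: Let_def c_def)
qed

end
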